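(* Let $m$ be a positive integer and $n=2m$. Suppose that $N$ is a subset of the cyclic group $\mathbb{Z}_{2m}$ such that $\{0,m\}\subseteq N$ and $|N|$ is odd. Then $N$ is not a direct factor of $\mathbb{Z}_{2m}$.
   Context: $\mathbb{Z}_{2m}$ is the additive group of integers modulo $2m$. A subset $N$ of an abelian group $G$ is a direct factor of $G$ if there is a subset $A\subseteq G$ such that every element of $G$ can be written uniquely as $x+a$ with $x\in N$, $a\in A$. *)

theory Defs
  imports "HOL-Algebra.Elementary_Groups"
begin

text \<open>HOL-Algebra writes the operation of every group multiplicatively; for
  \<^const>\<open>integer_mod_group\<close> it is addition of residues.  Uniqueness is that of the pair
  of factors; nesting \<open>\<exists>!\<close> over the two factors separately would be a different property.\<close>

definition direct_factor :: "('a, 'b) monoid_scheme \<Rightarrow> 'a set \<Rightarrow> bool" where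
  "direct_factor G N \<longleftrightarrow>
     N \<subseteq> carrier G \<and>
     (\<exists>A. A \<subseteq> carrier G \<and>
        (\<forall>g\<in>carrier G. \<exists>!p\<in>N \<times> A. g = fst p \<otimes>\<^bsub>G\<^esub> snd p))"

end

theory Submission
  imports Defs
begin

text \<open>If every group element is uniquely \<open>x a\<close> with \<open>x\<close> in \<open>N\<close> and \<open>a\<close> in \<open>A\<close>, then for a
  fixed \<open>g\<close> the relation ``\<open>g\<close> lies in \<open>x y A\<close>'' on \<open>N\<close> is the graph of an involution, because
  the group is abelian. When the size of \<open>N\<close> is odd this involution has a fixed point, so every \<open>g\<close> is of
  the form \<open>x\<^sup>2 a\<close>. By counting, \<open>(x, a) \<mapsto> x\<^sup>2 a\<close> is then injective, hence so is squaring
  on \<open>N\<close>. In the cyclic group of order \<open>2m\<close>, however, \<open>0\<close> and \<open>m\<close> have the same double.\<close>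

text \<open>Each orbit \<open>{x, f x}\<close> has exactly two elements, and removing one leaves a
  smaller set on which the hypotheses still hold.\<close>

lemma even_card_involution:
  assumes "finite S"
    and "\<And>x. x \<in> S \<Longrightarrow> f x \<in> S" "\<And>x. x \<in> S \<Longrightarrow> f (f x) = x" "\<And>x. x \<in> S \<Longrightarrow> f x \<noteq> x"
  shows "even (card S)"
  using assms
proof (induction S rule: finite_psubset_induct)
  case (psubset S)
  show ?case
  proof (cases "S = {}")
    case False
    then obtain x where x: "x \<in> S" by blast
    let ?T = "S - {x, f x}"
    have fx: "f x \<in> S" "f x \<noteq> x"
      using psubset.prems x by auto
    have "even (card ?T)"
    proof (rule psubset.IH)
      \<comment> \<open>Applying \<open>f\<close> to \<open>f y = x\<close> or to
        \<open>f y = f x\<close> would put \<open>y\<close> in the removed orbit.\<close>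
      show "f y \<in> ?T" if "y \<in> ?T" for y
        using psubset.prems(1)[of y] psubset.prems(2)[of y] psubset.prems(2)[of x] that x by auto
    qed (use x psubset.prems in auto)
    moreover have "card S = card ?T + card {x, f x}"
      using x fx psubset.hyps card_Diff_subset[of "{x, f x}" S] card_mono[of S "{x, f x}"] by simp
    ultimately show ?thesis
      using fx by simp
  qed simp
qed

context comm_group
begin

text \<open>In this form, unique factorization can be used both for cancelling and for
  counting.\<close>

lemma direct_factor_bij_betwE:
  assumes "direct_factor G N"
  obtains A where "N \<subseteq> carrier G" "A \<subseteq> carrier G"
    "bij_betw (\<lambda>p. fst p \<otimes> snd p) (N \<times> A) (carrier G)"
proof -
  let ?mul = "\<lambda>p. fst p \<otimes> snd p"
  obtain A where NG: "N \<subseteq> carrier G" and AG: "A \<subseteq> carrier G"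
    and uniq: "\<And>g. g \<in> carrier G \<Longrightarrow> \<exists>!p\<in>N \<times> A. g = fst p \<otimes> snd p"
    using assms[unfolded direct_factor_def] by (elim conjE exE) (rule that, assumption+, erule bspec)
  have closed: "?mul p \<in> carrier G" if "p \<in> N \<times> A" for p
    using that subsetD[OF NG] subsetD[OF AG] by auto
  have "bij_betw ?mul (N \<times> A) (carrier G)"
    unfolding bij_betw_def
  proof
    show "inj_on ?mul (N \<times> A)"
    proof (rule inj_onI)
      fix p q assume pq: "p \<in> N \<times> A" "q \<in> N \<times> A" "?mul p = ?mul q"
      from uniq[OF closed[OF pq(1)]] pq show "p = q"
        by blast
    qed
    show "?mul ` (N \<times> A) = carrier G"
    proof
      show "carrier G \<subseteq> ?mul ` (N \<times> A)"
        using uniq by blast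
    qed (use closed in blast)
  qed
  with NG AG show ?thesis by (rule that)
qed

lemma odd_factor_squares_cover:
  assumes N: "N \<subseteq> carrier G" "odd (card N)" and A: "A \<subseteq> carrier G"
    and bij: "bij_betw (\<lambda>p. fst p \<otimes> snd p) (N \<times> A) (carrier G)"
    and g: "g \<in> carrier G"
  shows "\<exists>x\<in>N. \<exists>a\<in>A. g = x \<otimes> x \<otimes> a"
proof -
  have fact_unique: "x = y"
    if "x \<in> N" "a \<in> A" "y \<in> N" "b \<in> A" "x \<otimes> a = y \<otimes> b" for x a y b
    using inj_onD[OF bij_betw_imp_inj_on[OF bij], of "(x, a)" "(y, b)"] that by simp
  \<comment> \<open>The partner \<open>y\<close> of \<open>x\<close> is the
    \<open>N\<close>-component of \<open>inv x \<otimes> g\<close>; choosing it for every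
    \<open>x\<close> gives the involution \<open>f\<close>.\<close>
  have "\<forall>x\<in>N. \<exists>y\<in>N. \<exists>a\<in>A. g = x \<otimes> y \<otimes> a"
  proof
    fix x assume x: "x \<in> N"
    then have "inv x \<otimes> g \<in> carrier G" using N g by auto
    then obtain y a where ya: "y \<in> N" "a \<in> A" "inv x \<otimes> g = y \<otimes> a"
      unfolding bij_betw_imp_surj_on[OF bij, symmetric] by (elim imageE) auto
    moreover have c: "x \<in> carrier G" "y \<in> carrier G" "a \<in> carrier G"
      using x ya N A by blast+
    ultimately have "g = x \<otimes> y \<otimes> a"
      using inv_solve_left[of "y \<otimes> a" x g] g by (simp add: m_assoc)
    with ya show "\<exists>y\<in>N. \<exists>a\<in>A. g = x \<otimes> y \<otimes> a" by blast
  qed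
  then obtain f where f: "\<And>x. x \<in> N \<Longrightarrow> f x \<in> N"
    and fa: "\<And>x. x \<in> N \<Longrightarrow> \<exists>a\<in>A. g = x \<otimes> f x \<otimes> a"
    by metis
  have "f (f x) = x" if x: "x \<in> N" for x
  proof -
    obtain a where a: "a \<in> A" "g = x \<otimes> f x \<otimes> a" using fa x by blast
    obtain b where b: "b \<in> A" "g = f x \<otimes> f (f x) \<otimes> b" using fa f x by blast
    have c: "x \<in> carrier G" "f x \<in> carrier G" "f (f x) \<in> carrier G" "a \<in> carrier G" "b \<in> carrier G"
      using x f a b N A by blast+
    \<comment> \<open>Both sides equal \<open>g\<close>, the right one by commutativity. Cancelling
      \<open>f x\<close> leaves two factorizations of one element, whose \<open>N\<close>-components
      must agree.\<close>
    have "f x \<otimes> (f (f x) \<otimes> b) = f x \<otimes> (x \<otimes> a)"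
      using a(2) b(2) c by (simp add: m_assoc m_lcomm)
    then have "f (f x) \<otimes> b = x \<otimes> a"
      using c by simp
    then show ?thesis
      using fact_unique x f a b by blast
  qed
  \<comment> \<open>An infinite set has \<open>card\<close> equal to 0, which is even.\<close>
  moreover have "finite N"
    using N(2) card.infinite by fastforce
  ultimately obtain x where "x \<in> N" "f x = x"
    using even_card_involution[of N f] f N(2) by blast
  then show ?thesis
    using fa by metis
qed

lemma direct_factor_odd_square_inj_on:
  assumes fin: "finite (carrier G)" and N: "direct_factor G N" "odd (card N)"
  shows "inj_on (\<lambda>x. x \<otimes> x) N"
proof (rule inj_onI)
  fix x y assume xy: "x \<in> N" "y \<in> N" "x \<otimes> x = y \<otimes> y"
  obtain A where NG: "N \<subseteq> carrier G" and AG: "A \<subseteq> carrier G"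
    and bij: "bij_betw (\<lambda>p. fst p \<otimes> snd p) (N \<times> A) (carrier G)"
    using N(1) by (rule direct_factor_bij_betwE)
  let ?sq = "\<lambda>p. fst p \<otimes> fst p \<otimes> snd p"
  have finNA: "finite (N \<times> A)"
    using bij_betw_finite[OF bij] fin by simp
  have "card (N \<times> A) = card (carrier G)"
    using bij by (rule bij_betw_same_card)
  moreover have "?sq ` (N \<times> A) = carrier G"
  proof
    show "carrier G \<subseteq> ?sq ` (N \<times> A)"
      using odd_factor_squares_cover[OF NG N(2) AG bij] by force
    show "?sq ` (N \<times> A) \<subseteq> carrier G"
      using subsetD[OF NG] subsetD[OF AG] by auto
  qed
  \<comment> \<open>A map from a finite set onto a set of the same size is injective.\<close>
  ultimately have inj: "inj_on ?sq (N \<times> A)"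
    using finNA by (simp add: eq_card_imp_inj_on)
  \<comment> \<open>Injectivity concerns pairs, so some element of \<open>A\<close> is needed to
    pair with \<open>x\<close> and \<open>y\<close>; covering the identity supplies one.\<close>
  obtain a where a: "a \<in> A"
    using odd_factor_squares_cover[OF NG N(2) AG bij one_closed] by blast
  then have "(x, a) = (y, a)"
    using xy by (intro inj_onD[OF inj]) auto
  then show "x = y" by simp
qed

end

theorem theorem3p4:
  fixes m :: nat and N :: "int set"
  assumes "m > 0"
    and "N \<subseteq> carrier (integer_mod_group (2 * m))"
    and "{0, int m} \<subseteq> N"
    and "odd (card N)"
  shows "\<not> direct_factor (integer_mod_group (2 * m)) N"
proof
  let ?G = "integer_mod_group (2 * m)"
  assume "direct_factor ?G N"
  moreover have "comm_group ?G"
    by (simp add: abelian_integer_mod_group)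
  moreover have "finite (carrier ?G)"
    using assms(1) by (simp add: carrier_integer_mod_group)
  ultimately have "inj_on (\<lambda>x. x \<otimes>\<^bsub>?G\<^esub> x) N"
    using assms(4) by (intro comm_group.direct_factor_odd_square_inj_on)
  \<comment> \<open>The sum of \<open>int m\<close> with itself is the modulus, so it reduces to
    0.\<close>
  moreover have "0 \<otimes>\<^bsub>?G\<^esub> 0 = int m \<otimes>\<^bsub>?G\<^esub> int m"
    by simp
  ultimately have "0 = int m"
    by (rule inj_onD) (use assms(3) in simp_all)
  then show False
    using assms(1) by simp
qed

end
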